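(* Let $q$ be an odd prime power and $m>1$ an integer with $m\mid q+1$. Define $\psi:\mathbb{F}_{q^2}\to\mathbb{F}_{q^2}$ by $\psi(\gamma)=\frac{\alpha\gamma+d}{\gamma-\alpha}$ for $\gamma\ne\alpha$ and $\psi(\alpha)=\alpha$. Let $c_1,\dots,c_{\frac{q+1-m}{m}}$ be the points where the line $\mathbb{F}_q$ meets the $m$-ary lines through $\alpha$ other than the line $\{c+\alpha:c\in\mathbb{F}_q\}$. If $m\nmid\frac{q+1}{2}$, then $\psi(\alpha Q_0)=\{\alpha,c_1,\dots,c_{\frac{q+1-m}{m}}\}$, a clique of size $\frac{q+1}{m}$ in $\mathrm{GP}(q^2,m)$. If $m\mid\frac{q+1}{2}$, then $\psi(\{0\}\cup\alpha Q_0)=\{\pm\alpha,c_1,\dots,c_{\frac{q+1-m}{m}}\}$, a clique of size $\frac{q+1+m}{m}$ in $\mathrm{GP}(q^2,m)$.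
   Context: The generalised Paley graph $\mathrm{GP}(q^2,m)$ has vertex set $\mathbb{F}_{q^2}$, with two distinct vertices $x,y$ adjacent iff $x-y$ is an $m$-th power of an element of $\mathbb{F}_{q^2}^*$. Fix a non-square $d\in\mathbb{F}_q^*$ and $\alpha\in\mathbb{F}_{q^2}$ with $\alpha^2=d$, so $\mathbb{F}_{q^2}=\{x+y\alpha:x,y\in\mathbb{F}_q\}$ is viewed as the affine plane $AG(2,q)$. A line is a set $\{a+cs:c\in\mathbb{F}_q\}$ with $a\in\mathbb{F}_{q^2}$, $s\in\mathbb{F}_{q^2}^*$; it is $m$-ary if its slope $s$ is an $m$-th power in $\mathbb{F}_{q^2}^*$. Fix a primitive element $\beta$ of $\mathbb{F}_{q^2}$, let $\omega=\beta^{q-1}$, $Q_0=\langle\omega^m\rangle$ and $\alpha Q_0=\{\alpha\gamma:\gamma\in Q_0\}$. *)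

theory Defs
  imports "HOL-Library.Ramsey" "HOL-Number_Theory.Prime_Powers"
begin

text \<open>
  \<open>\<bbbF>\<close> of order \<open>q\<^sup>2\<close> is a type of class \<open>{field, finite}\<close> with \<open>q\<^sup>2\<close> elements; \<open>\<bbbF>\<^sub>q\<close> is a
  subset \<open>K\<close> that is a subfield with \<open>q\<close> elements.
\<close>

definition is_subfield :: "'a::field set \<Rightarrow> bool" where
  "is_subfield K \<longleftrightarrow>
     0 \<in> K \<and> 1 \<in> K \<and>
     (\<forall>x\<in>K. \<forall>y\<in>K. x + y \<in> K \<and> x * y \<in> K) \<and>
     (\<forall>x\<in>K. - x \<in> K \<and> inverse x \<in> K)"

definition unit_power :: "nat \<Rightarrow> 'a::field \<Rightarrow> bool" where
  "unit_power m s \<longleftrightarrow> (\<exists>z. z \<noteq> 0 \<and> s = z ^ m)"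

definition primitive_element :: "'a::field \<Rightarrow> bool" where
  "primitive_element \<beta> \<longleftrightarrow> \<beta> \<noteq> 0 \<and> (\<forall>x. x \<noteq> 0 \<longrightarrow> (\<exists>k::nat. x = \<beta> ^ k))"

definition cyclic_subgroup :: "'a::field \<Rightarrow> 'a set" where
  "cyclic_subgroup g = range (\<lambda>k::int. g powi k)"

text \<open>
  The edge set of the generalised Paley graph, whose vertex set is the whole field.
  For odd \<open>q\<close> with \<open>m dvd q + 1\<close>, the element \<open>-1\<close> of \<open>K\<close> is an \<open>m\<close>-th power, so the order in
  which the end points of an edge are subtracted is irrelevant.
\<close>

definition GP_edges :: "nat \<Rightarrow> 'a::field set set" where
  "GP_edges m = {{x, y} | x y. x \<noteq> y \<and> unit_power m (x - y)}"

definition line :: "'a::field set \<Rightarrow> 'a \<Rightarrow> 'a \<Rightarrow> 'a set" where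
  "line K a s = {a + c * s | c. c \<in> K}"

text \<open>
  The slope of a line is determined only up to a nonzero factor in \<open>K\<close>. For \<open>m dvd q + 1\<close> all
  these factors are \<open>m\<close>-th powers in the big field, so one slope is an \<open>m\<close>-th power iff all are.
\<close>

definition mary_line :: "'a::field set \<Rightarrow> nat \<Rightarrow> 'a set \<Rightarrow> bool" where
  "mary_line K m L \<longleftrightarrow> (\<exists>a s. s \<noteq> 0 \<and> unit_power m s \<and> L = line K a s)"

text \<open>
  The points \<open>c\<^sub>1, c\<^sub>2, \<dots>\<close> where the line \<open>K\<close> meets the \<open>m\<close>-ary lines through \<open>\<alpha>\<close> other than the
  parallel \<open>{c + \<alpha> | c. c \<in> K}\<close> of \<open>K\<close>.
\<close>

definition meeting_points :: "'a::field set \<Rightarrow> nat \<Rightarrow> 'a \<Rightarrow> 'a set" where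
  "meeting_points K m \<alpha> =
     (\<Union>L \<in> {L. mary_line K m L \<and> \<alpha> \<in> L \<and> L \<noteq> {c + \<alpha> | c. c \<in> K}}. K \<inter> L)"

definition psi :: "'a::field \<Rightarrow> 'a \<Rightarrow> 'a \<Rightarrow> 'a" where
  "psi \<alpha> d \<gamma> = (if \<gamma> = \<alpha> then \<alpha> else (\<alpha> * \<gamma> + d) / (\<gamma> - \<alpha>))"

end

theory Submission
  imports Defs
begin

text \<open>
  Write \<open>n = (q + 1) div m\<close>. Since \<open>x \<mapsto> x ^ q\<close> is the conjugation that fixes \<open>K\<close> and negates \<open>\<alpha>\<close>,
  every \<open>c \<in> K\<close> satisfies \<open>(c - \<alpha>) ^ (q - 1) = (c + \<alpha>) / (c - \<alpha>)\<close>. Hence \<open>c - \<alpha>\<close> is an \<open>m\<close>-th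
  power iff \<open>\<delta> = (c + \<alpha>) / (c - \<alpha>)\<close> satisfies \<open>\<delta> ^ n = 1\<close>, i.e. lies in \<open>Q\<^sub>0\<close>. As \<open>\<psi>\<close> is an
  involution that exchanges \<open>c\<close> with \<open>\<alpha> * \<delta>\<close> and \<open>0\<close> with \<open>- \<alpha>\<close>, this gives the images and their
  sizes. For the cliques, nonzero elements of \<open>K\<close> are \<open>m\<close>-th powers, and \<open>2 * \<alpha>\<close> is one as
  \<open>\<alpha> ^ ((q - 1) * n) = (-1) ^ n\<close>, where \<open>n\<close> is even if \<open>m dvd (q + 1) div 2\<close>.
\<close>

section \<open>Powers and roots of unity in a finite field\<close>

text \<open>Multiplication by \<open>a\<close> permutes \<open>S\<close>, so it leaves the nonzero
  product of \<open>S\<close> unchanged. Applied to all units of the field and to those of a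
  subfield, this is Fermat's little theorem.\<close>

lemma power_card_eq_1:
  fixes a :: "'a::field"
  assumes "finite S" "0 \<notin> S" "a \<noteq> 0" "\<And>x. x \<in> S \<Longrightarrow> a * x \<in> S"
  shows "a ^ card S = 1"
proof -
  have inj: "inj_on (\<lambda>x. a * x) S"
    using assms(3) by (auto simp: inj_on_def)
  have "(\<lambda>x. a * x) ` S = S"
    using assms(1,4) inj by (intro endo_inj_surj) auto
  then have "\<Prod>S = (\<Prod>x\<in>S. a * x)"
    using prod.reindex[OF inj, of "\<lambda>x. x"] by simp
  also have "\<dots> = a ^ card S * \<Prod>S"
    by (simp add: prod.distrib)
  finally show ?thesis
    using assms(1,2) by auto
qed

text \<open>A generator of the unit group has order exactly the number \<open>N\<close> of units:
  Fermat gives \<open>\<beta> ^ N = 1\<close>, and a smaller order would leave too few powers to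
  cover all units.\<close>

lemma primitive_element_power_eq_1_iff:
  fixes \<beta> :: "'a::{field, finite}"
  assumes "primitive_element \<beta>"
  shows "\<beta> ^ k = 1 \<longleftrightarrow> card (UNIV :: 'a set) - 1 dvd k"
proof -
  define N where "N = card (UNIV :: 'a set) - 1"
  have \<beta>0: "\<beta> \<noteq> 0" and surj: "\<And>x. x \<noteq> 0 \<Longrightarrow> \<exists>k. x = \<beta> ^ k"
    using assms by (auto simp: primitive_element_def)
  have card: "card (UNIV - {0 :: 'a}) = N"
    by (simp add: N_def card_Diff_singleton)
  have \<beta>N: "\<beta> ^ N = 1"
    using power_card_eq_1[of "UNIV - {0}" \<beta>] \<beta>0 card by simp
  have Npos: "N > 0"
    using card card_gt_0_iff[of "UNIV - {0::'a}"] \<beta>0 by auto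
  show ?thesis unfolding N_def[symmetric]
  proof
    assume "N dvd k"
    then show "\<beta> ^ k = 1"
      using \<beta>N by (auto simp: power_mult)
  next
    assume k: "\<beta> ^ k = 1"
    define r where "r = k mod N"
    have "\<beta> ^ k = (\<beta> ^ N) ^ (k div N) * \<beta> ^ r"
      unfolding r_def power_mult[symmetric] power_add[symmetric] by simp
    then have r1: "\<beta> ^ r = 1"
      using k \<beta>N by simp
    have "r = 0"
    proof (rule ccontr)
      assume r: "r \<noteq> 0"
      \<comment> \<open>Exponents can be reduced modulo \<open>r\<close>, so at most
        \<open>r\<close> units would exist, although \<open>r < N\<close>.\<close>
      have "UNIV - {0} \<subseteq> (\<lambda>i. \<beta> ^ i) ` {..<r}"
      proof
        fix x :: 'a
        assume "x \<in> UNIV - {0}"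
        then obtain j where j: "x = \<beta> ^ j"
          using surj by auto
        have "\<beta> ^ j = (\<beta> ^ r) ^ (j div r) * \<beta> ^ (j mod r)"
          unfolding power_mult[symmetric] power_add[symmetric] by simp
        then have "x = \<beta> ^ (j mod r)"
          using j r1 by simp
        then show "x \<in> (\<lambda>i. \<beta> ^ i) ` {..<r}"
          using r by auto
      qed
      then have "N \<le> r"
        using card surj_card_le[of "{..<r}" "UNIV - {0}" "\<lambda>i. \<beta> ^ i"] by simp
      moreover have "r < N"
        using Npos by (simp add: r_def)
      ultimately show False
        by simp
    qed
    then show "N dvd k"
      by (simp add: r_def mod_eq_0_iff_dvd)
  qed
qed

lemma primitive_element_power_inj:
  fixes \<beta> :: "'a::{field, finite}"
  assumes "primitive_element \<beta>" "\<beta> ^ i = \<beta> ^ j" "i \<le> j"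
    "j - i < card (UNIV :: 'a set) - 1"
  shows "i = j"
proof -
  have "\<beta> ^ i * \<beta> ^ (j - i) = \<beta> ^ i * 1"
    using assms(2) le_add_diff_inverse[OF assms(3)] by (metis mult_1_right power_add)
  then have "\<beta> ^ (j - i) = 1"
    using assms(1) by (auto simp: primitive_element_def)
  then show ?thesis
    using primitive_element_power_eq_1_iff[OF assms(1), of "j - i"] assms(3,4)
    by (auto dest: dvd_imp_le)
qed

text \<open>With \<open>x = \<beta> ^ k\<close>, the equation \<open>x ^ n = 1\<close> says that
  \<open>r * n\<close> divides \<open>k * n\<close>, that is, \<open>r\<close> divides
  \<open>k\<close>. The quotient exponent matters only modulo \<open>n\<close>.\<close>

lemma roots_of_unity_eq_powers:
  fixes \<beta> :: "'a::{field, finite}"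
  assumes \<beta>: "primitive_element \<beta>" and card: "card (UNIV :: 'a set) - 1 = r * n" and pos: "r * n > 0"
  shows "{x. x ^ n = 1} = (\<lambda>i. (\<beta> ^ r) ^ i) ` {..<n}"
    and "card {x :: 'a. x ^ n = 1} = n"
proof -
  have \<beta>rn: "\<beta> ^ (r * n) = 1"
    using primitive_element_power_eq_1_iff[OF \<beta>] card by simp
  show eq: "{x. x ^ n = 1} = (\<lambda>i. (\<beta> ^ r) ^ i) ` {..<n}"
  proof (intro set_eqI iffI)
    fix x :: 'a
    assume "x \<in> {x. x ^ n = 1}"
    then have x: "x ^ n = 1"
      by simp
    then have "x \<noteq> 0"
      using pos by (auto simp: zero_power)
    then obtain k where k: "x = \<beta> ^ k"
      using \<beta> by (auto simp: primitive_element_def)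
    have "\<beta> ^ (k * n) = 1"
      using x by (simp add: k power_mult)
    then have "r * n dvd k * n"
      using primitive_element_power_eq_1_iff[OF \<beta>] card by simp
    then obtain l where l: "k = r * l"
      using pos by (auto elim: dvdE)
    have "l = l mod n + n * (l div n)"
      by simp
    then have "x = \<beta> ^ (r * (l mod n)) * (\<beta> ^ (r * n)) ^ (l div n)"
      unfolding k l power_mult[symmetric] power_add[symmetric]
      by (metis distrib_left mult.assoc)
    then have "x = (\<beta> ^ r) ^ (l mod n)"
      unfolding \<beta>rn by (simp add: power_mult)
    then show "x \<in> (\<lambda>i. (\<beta> ^ r) ^ i) ` {..<n}"
      using pos by auto
  next
    fix x :: 'a
    assume "x \<in> (\<lambda>i. (\<beta> ^ r) ^ i) ` {..<n}"
    then obtain i where "x = (\<beta> ^ r) ^ i"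
      by auto
    then have "x ^ n = (\<beta> ^ (r * n)) ^ i"
      by (simp add: power_mult[symmetric] mult_ac)
    then show "x \<in> {x. x ^ n = 1}"
      using \<beta>rn by simp
  qed
  \<comment> \<open>The order of \<open>\<beta>\<close> is \<open>r * n\<close>, and for
    \<open>i \<le> j < n\<close> the exponents differ by less than that. The assumption
    \<open>i \<le> j\<close> costs no generality.\<close>
  have main: "i = j" if "(\<beta> ^ r) ^ i = (\<beta> ^ r) ^ j" "j < n" "i \<le> j" for i j
  proof -
    have "r * j - r * i < r * n"
      using that pos by (simp add: diff_mult_distrib2[symmetric])
    then have "r * i = r * j"
      using that card by (intro primitive_element_power_inj[OF \<beta>]) (auto simp: power_mult)
    then show ?thesis
      using pos by simp
  qed
  have "inj_on (\<lambda>i. (\<beta> ^ r) ^ i) {..<n}"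
  proof (rule inj_onI)
    fix i j
    assume "i \<in> {..<n}" "j \<in> {..<n}" "(\<beta> ^ r) ^ i = (\<beta> ^ r) ^ j"
    then show "i = j"
      using main[of i j] main[of j i] by (cases "i \<le> j") auto
  qed
  then show "card {x :: 'a. x ^ n = 1} = n"
    by (simp add: eq card_image)
qed

lemma cyclic_subgroup_eq_roots_of_unity:
  fixes \<beta> :: "'a::{field, finite}"
  assumes \<beta>: "primitive_element \<beta>" and card: "card (UNIV :: 'a set) - 1 = r * n" and pos: "r * n > 0"
  shows "cyclic_subgroup (\<beta> ^ r) = {x. x ^ n = 1}"
proof
  show "{x. x ^ n = 1} \<subseteq> cyclic_subgroup (\<beta> ^ r)"
  proof
    fix x :: 'a
    assume "x \<in> {x. x ^ n = 1}"
    then obtain i where "x = (\<beta> ^ r) ^ i"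
      using roots_of_unity_eq_powers(1)[OF assms] by auto
    then have "x = (\<beta> ^ r) powi (int i)"
      by simp
    then show "x \<in> cyclic_subgroup (\<beta> ^ r)"
      unfolding cyclic_subgroup_def by (rule range_eqI)
  qed
  have "((\<beta> ^ r) powi k) ^ n = 1" for k
  proof -
    have "((\<beta> ^ r) powi k) ^ n = ((\<beta> ^ r) ^ n) powi k"
      by (simp add: power_int_def power_mult[symmetric] mult_ac power_inverse)
    also have "(\<beta> ^ r) ^ n = 1"
      using primitive_element_power_eq_1_iff[OF \<beta>, of "r * n"] card by (simp add: power_mult)
    finally show ?thesis
      by simp
  qed
  then show "cyclic_subgroup (\<beta> ^ r) \<subseteq> {x. x ^ n = 1}"
    by (auto simp: cyclic_subgroup_def)
qed

text \<open>Euler's criterion for \<open>m\<close>-th powers: they are the powers of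
  \<open>\<beta> ^ m\<close>, hence the \<open>r\<close>-th roots of unity.\<close>

lemma unit_power_iff_power_eq_1:
  fixes \<beta> u :: "'a::{field, finite}"
  assumes \<beta>: "primitive_element \<beta>" and card: "card (UNIV :: 'a set) - 1 = m * r" and pos: "m * r > 0"
  shows "unit_power m u \<longleftrightarrow> u ^ r = 1"
proof
  assume "unit_power m u"
  then obtain z where z: "z \<noteq> 0" "u = z ^ m"
    by (auto simp: unit_power_def)
  then obtain k where "z = \<beta> ^ k"
    using \<beta> by (auto simp: primitive_element_def)
  then have "u ^ r = \<beta> ^ (k * (m * r))"
    by (simp add: z power_mult)
  then show "u ^ r = 1"
    using primitive_element_power_eq_1_iff[OF \<beta>] card by simp
next
  assume "u ^ r = 1"
  then obtain i where "u = (\<beta> ^ m) ^ i"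
    using roots_of_unity_eq_powers(1)[OF \<beta> card pos] by auto
  then have "u = (\<beta> ^ i) ^ m"
    by (simp add: power_mult[symmetric] mult_ac)
  then show "unit_power m u"
    using \<beta> unfolding unit_power_def primitive_element_def by (intro exI[of _ "\<beta> ^ i"]) simp
qed

section \<open>Additivity of the Frobenius map\<close>

text \<open>Translation by 1 permutes \<open>K\<close>, so it preserves the sum of \<open>K\<close>,
  yet it adds 1 once for each element.\<close>

lemma card_subfield_eq_0:
  fixes K :: "'a::{field, finite} set"
  assumes "is_subfield K"
  shows "of_nat (card K) = (0 :: 'a)"
proof -
  have inj: "inj_on (\<lambda>x. x + 1) K"
    by (auto simp: inj_on_def)
  have "(\<lambda>x. x + 1) ` K = K"
    using assms inj by (intro endo_inj_surj) (auto simp: is_subfield_def)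
  then have "\<Sum>K = (\<Sum>x\<in>K. x + 1)"
    using sum.reindex[OF inj, of "\<lambda>x. x"] by simp
  then show ?thesis
    by (simp add: sum.distrib)
qed

text \<open>The order of \<open>K\<close> is a power of a prime \<open>p\<close> and vanishes in the
  field, so the characteristic is \<open>p\<close> and \<open>card K\<close> is a power of
  it.\<close>

lemma power_card_subfield_add:
  fixes K :: "'a::{field, finite} set" and x y :: 'a
  assumes K: "is_subfield K" and q: "primepow (card K)"
  shows "(x + y) ^ card K = x ^ card K + y ^ card K"
proof -
  obtain p k where pk: "prime p" "card K = p ^ k"
    using q by (auto simp: primepow_def)
  have prime: "prime CHAR('a)"
    by (rule prime_CHAR_semidom) (simp add: finite_imp_CHAR_pos)
  have "CHAR('a) dvd p ^ k"
    using card_subfield_eq_0[OF K] by (simp add: of_nat_eq_0_iff_char_dvd flip: pk(2))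
  then have "CHAR('a) = p"
    using prime pk(1) by (metis prime_dvd_power primes_dvd_imp_eq)
  then show ?thesis
    using freshmans_dream'[OF prime, of "card K" k x y] pk(2) by simp
qed

section \<open>Conjugation over \<open>K\<close> and \<open>m\<close>-th powers\<close>

text \<open>The parameter \<open>n\<close> stands for the quotient of \<open>q + 1\<close> by
  \<open>m\<close>; the equation \<open>mn\<close> replaces divisibility and division.\<close>

locale affine_plane =
  fixes q m n :: nat and K :: "'a::{field, finite} set" and d \<alpha> \<beta> :: 'a
  assumes q: "primepow q" "odd q"
    and mn: "q + 1 = m * n"
    and field_card: "card (UNIV :: 'a set) = q\<^sup>2"
    and K: "is_subfield K" "card K = q"
    and d: "d \<in> K" "d \<noteq> 0" "\<not> (\<exists>x\<in>K. x\<^sup>2 = d)"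
    and \<alpha>: "\<alpha>\<^sup>2 = d"
    and \<beta>: "primitive_element \<beta>"
begin

lemma q_gt_1: "q > 1"
  using primepow_gt_Suc_0[OF q(1)] by simp

lemma card_units: "card (UNIV :: 'a set) - 1 = (q - 1) * (q + 1)"
  using q_gt_1 by (simp add: field_card power2_eq_square algebra_simps)

lemma n_pos: "n > 0" and m_pos: "m > 0"
  using mn by (auto intro!: Nat.gr0I)

lemma units_factor: "card (UNIV :: 'a set) - 1 = m * ((q - 1) * n)"
  unfolding card_units mn by (simp add: mult_ac)

lemma factor_pos: "m * ((q - 1) * n) > 0"
  using q_gt_1 n_pos m_pos by simp

lemma unit_power_iff: "unit_power m u \<longleftrightarrow> u ^ ((q - 1) * n) = 1" for u :: 'a
  by (rule unit_power_iff_power_eq_1[OF \<beta> units_factor factor_pos])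

lemma unit_power_mult: "unit_power m u \<Longrightarrow> unit_power m v \<Longrightarrow> unit_power m (u * v)" for u v :: 'a
  by (simp add: unit_power_iff power_mult_distrib)

text \<open>If 2 vanished, the odd number \<open>q\<close> would equal 1 in the field, but it is 0
  there as the order of \<open>K\<close>.\<close>

lemma two_nonzero: "(2 :: 'a) \<noteq> 0"
proof
  assume "(2 :: 'a) = 0"
  obtain k where k: "q = 2 * k + 1"
    using q(2) by (auto elim: oddE)
  have "of_nat q = (1 :: 'a)"
    using \<open>(2 :: 'a) = 0\<close> by (simp add: k)
  then show False
    using card_subfield_eq_0[OF K(1)] K(2) by simp
qed

lemma K_closed:
  "0 \<in> K" "1 \<in> K" "x \<in> K \<Longrightarrow> y \<in> K \<Longrightarrow> x + y \<in> K" "x \<in> K \<Longrightarrow> y \<in> K \<Longrightarrow> x * y \<in> K"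
  "x \<in> K \<Longrightarrow> - x \<in> K" "x \<in> K \<Longrightarrow> y \<in> K \<Longrightarrow> x - y \<in> K"
  using K(1) unfolding is_subfield_def diff_conv_add_uminus by blast+

text \<open>The \<open>q - 1\<close> units of \<open>K\<close> are roots of unity of this exponent
  by Fermat, and the field has only \<open>q - 1\<close> such roots.\<close>

lemma unit_mem_K_iff: "x \<in> K - {0} \<longleftrightarrow> x ^ (q - 1) = 1"
proof -
  have card: "card (K - {0}) = q - 1"
    using K_closed(1) K(2) by simp
  have sub: "K - {0} \<subseteq> {x. x ^ (q - 1) = 1}"
    using power_card_eq_1[of "K - {0}"] K_closed(4) by (auto simp: card)
  have "card {x :: 'a. x ^ (q - 1) = 1} = q - 1"
    using q_gt_1 card_units
    by (intro roots_of_unity_eq_powers(2)[OF \<beta>, of "q + 1"]) (auto simp: mult_ac)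
  then have "K - {0} = {x. x ^ (q - 1) = 1}"
    using card by (intro card_subset_eq[OF _ sub]) auto
  then show ?thesis
    by blast
qed

lemma power_q: "x ^ q = x * x ^ (q - 1)" for x :: 'a
  using q_gt_1 by (simp flip: power_Suc)

text \<open>\<open>K\<close> is the fixed field of conjugation, which turns membership in
  \<open>K\<close> into an equation.\<close>

lemma mem_K_iff: "x \<in> K \<longleftrightarrow> x ^ q = x"
  using unit_mem_K_iff[of x] K_closed(1) q_gt_1 by (cases "x = 0") (auto simp: power_q)

lemma unit_power_K: "x \<in> K \<Longrightarrow> x \<noteq> 0 \<Longrightarrow> unit_power m x"
  using unit_mem_K_iff[of x] by (simp add: unit_power_iff power_mult)

lemma \<alpha>_nonzero: "\<alpha> \<noteq> 0"
  using \<alpha> d(2) by auto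

lemma \<alpha>_notin_K: "\<alpha> \<notin> K" and minus_\<alpha>_notin_K: "- \<alpha> \<notin> K"
  using d(3) \<alpha> by (auto dest: bspec)

text \<open>Conjugation fixes \<open>d\<close>, so it maps \<open>\<alpha>\<close> to a square root
  of \<open>d\<close>; this is not \<open>\<alpha>\<close> itself, which lies outside
  \<open>K\<close>.\<close>

lemma \<alpha>_power_q: "\<alpha> ^ q = - \<alpha>"
proof -
  have "(\<alpha> ^ q)\<^sup>2 = d ^ q"
    unfolding \<alpha>[symmetric] power_mult[symmetric] by (simp add: mult.commute)
  also have "\<dots> = \<alpha>\<^sup>2"
    using d(1) \<alpha> mem_K_iff by simp
  finally show ?thesis
    using \<alpha>_notin_K mem_K_iff by (auto simp: power2_eq_iff)
qed

lemma add_power_q: "(x + y) ^ q = x ^ q + y ^ q" for x y :: 'a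
  using power_card_subfield_add[of K x y] K q(1) by simp

lemma diff_power_q: "(x - y) ^ q = x ^ q - y ^ q" for x y :: 'a
  using add_power_q[of "x - y" y] by simp

lemma conj_quotient:
  assumes "c \<in> K"
  shows "(c - \<alpha>) ^ (q - 1) = (c + \<alpha>) / (c - \<alpha>)"
proof -
  have "c - \<alpha> \<noteq> 0"
    using assms \<alpha>_notin_K by auto
  moreover have "(c - \<alpha>) * (c - \<alpha>) ^ (q - 1) = c + \<alpha>"
    using assms by (simp add: diff_power_q \<alpha>_power_q mem_K_iff power_q[symmetric] del: One_nat_def)
  ultimately show ?thesis
    by (simp add: field_simps)
qed

lemma unit_power_diff_\<alpha>_iff:
  "c \<in> K \<Longrightarrow> unit_power m (c - \<alpha>) \<longleftrightarrow> ((c + \<alpha>) / (c - \<alpha>)) ^ n = 1"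
  by (simp only: unit_power_iff power_mult conj_quotient)

section \<open>The points where \<open>K\<close> meets the \<open>m\<close>-ary lines through
  \<open>\<alpha>\<close>\<close>

text \<open>Two points of a line differ by a multiple of its slope by an element of
  \<open>K\<close>, nonzero if the points are distinct and then an \<open>m\<close>-th power.
  Conversely, \<open>c - \<alpha>\<close> is itself a slope of the line joining
  \<open>\<alpha>\<close> and \<open>c\<close>.\<close>

lemma meeting_points_eq: "meeting_points K m \<alpha> = {c \<in> K. unit_power m (c - \<alpha>)}"
proof (intro set_eqI iffI)
  fix c
  assume "c \<in> meeting_points K m \<alpha>"
  then obtain a s where as: "unit_power m s" "\<alpha> \<in> line K a s" "c \<in> K" "c \<in> line K a s"
    unfolding meeting_points_def mary_line_def by blast
  obtain c0 c1 where c: "c0 \<in> K" "\<alpha> = a + c0 * s" "c1 \<in> K" "c = a + c1 * s"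
    using as by (auto simp: line_def)
  have eq: "c - \<alpha> = (c1 - c0) * s"
    by (simp add: c algebra_simps)
  moreover have "c1 - c0 \<noteq> 0"
    using eq as(3) \<alpha>_notin_K by auto
  then have "unit_power m ((c1 - c0) * s)"
    using c as(1) by (intro unit_power_mult[OF unit_power_K] K_closed) auto
  ultimately show "c \<in> {c \<in> K. unit_power m (c - \<alpha>)}"
    using as(3) by simp
next
  fix c
  assume c: "c \<in> {c \<in> K. unit_power m (c - \<alpha>)}"
  have "c - \<alpha> \<noteq> 0"
    using c \<alpha>_notin_K by auto
  then have "mary_line K m (line K \<alpha> (c - \<alpha>))"
    using c unfolding mary_line_def by blast
  moreover have "\<alpha> \<in> line K \<alpha> (c - \<alpha>)"
    using K_closed(1) by (force simp: line_def)
  moreover have c_mem: "c \<in> line K \<alpha> (c - \<alpha>)"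
    using K_closed(2) by (force simp: line_def)
  \<comment> \<open>The excluded line is parallel to \<open>K\<close> and misses it, because
    \<open>\<alpha>\<close> is not in \<open>K\<close>.\<close>
  moreover have "c \<notin> {c + \<alpha> | c. c \<in> K}"
  proof
    assume "c \<in> {c + \<alpha> | c. c \<in> K}"
    then obtain b where "b \<in> K" "c = b + \<alpha>"
      by blast
    then have "c - b = \<alpha>"
      by simp
    then show False
      using \<alpha>_notin_K K_closed(6) c \<open>b \<in> K\<close> by auto
  qed
  ultimately show "c \<in> meeting_points K m \<alpha>"
    using c unfolding meeting_points_def by blast
qed

section \<open>The map \<open>psi\<close> and its images\<close>

text \<open>For \<open>\<gamma> \<noteq> \<alpha>\<close>, the relation
  \<open>\<alpha>\<^sup>2 = d\<close> gives \<open>psi \<alpha> d \<gamma> - \<alpha> = 2 * d /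
  (\<gamma> - \<alpha>)\<close>. So \<open>psi\<close> is an inversion centred at
  \<open>\<alpha>\<close>, with the centre fixed by convention.\<close>

lemma psi_involution: "psi \<alpha> d (psi \<alpha> d \<gamma>) = \<gamma>"
proof (cases "\<gamma> = \<alpha>")
  case True
  then show ?thesis
    by (simp add: psi_def)
next
  case False
  then have g: "\<gamma> - \<alpha> \<noteq> 0"
    by simp
  have d2: "2 * d \<noteq> 0"
    using d(2) two_nonzero by simp
  define w where "w = (\<alpha> * \<gamma> + d) / (\<gamma> - \<alpha>)"
  have w: "w * (\<gamma> - \<alpha>) = \<alpha> * \<gamma> + d"
    using g by (simp add: w_def)
  have 1: "(w - \<alpha>) * (\<gamma> - \<alpha>) = 2 * d"
    using w \<alpha> by (simp add: algebra_simps power2_eq_square)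
  have 2: "(\<alpha> * w + d) * (\<gamma> - \<alpha>) = 2 * d * \<gamma>"
  proof -
    have "(\<alpha> * w + d) * (\<gamma> - \<alpha>) = \<alpha> * (w * (\<gamma> - \<alpha>)) + d * (\<gamma> - \<alpha>)"
      by (simp add: algebra_simps)
    then show ?thesis
      using \<alpha> unfolding w by (simp add: algebra_simps power2_eq_square)
  qed
  have wa: "w \<noteq> \<alpha>"
    using 1 d2 by auto
  have "(\<alpha> * w + d) * (\<gamma> - \<alpha>) = \<gamma> * (w - \<alpha>) * (\<gamma> - \<alpha>)"
    unfolding 2 mult.assoc 1 by (simp add: mult_ac)
  then have "\<alpha> * w + d = \<gamma> * (w - \<alpha>)"
    using g by (simp only: mult_cancel_right) simp
  then have "(\<alpha> * w + d) / (w - \<alpha>) = \<gamma>"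
    using wa by simp
  then show ?thesis
    using False wa by (simp add: psi_def flip: w_def)
qed

lemma inj_psi: "inj_on (psi \<alpha> d) A"
  by (metis psi_involution inj_onI)

text \<open>Conjugation inverts \<open>\<delta>\<close> and negates \<open>\<alpha>\<close>, and
  these two effects cancel in \<open>\<alpha> * (\<delta> + 1) / (\<delta> - 1)\<close>, which
  therefore lies in \<open>K\<close>.\<close>

lemma psi_root_of_unity:
  assumes "\<delta> ^ n = 1" "\<delta> \<noteq> 1"
  shows "psi \<alpha> d (\<alpha> * \<delta>) \<in> meeting_points K m \<alpha>"
proof -
  have \<delta>1: "\<delta> - 1 \<noteq> 0"
    using assms(2) by simp
  \<comment> \<open>This is the solution of
    \<open>(c + \<alpha>) / (c - \<alpha>) = \<delta>\<close>.\<close>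
  define c where "c = \<alpha> * (\<delta> + 1) / (\<delta> - 1)"
  \<comment> \<open>Since \<open>q + 1 = m * n\<close>, the norm of \<open>\<delta>\<close> to
    \<open>K\<close> is 1.\<close>
  have "\<delta> * \<delta> ^ q = (\<delta> ^ n) ^ m"
    using mn by (simp add: mult.commute flip: power_Suc power_mult)
  then have e: "\<delta> * \<delta> ^ q = 1"
    using assms(1) by simp
  then have e1: "\<delta> ^ q - 1 \<noteq> 0"
    using \<delta>1 by auto
  \<comment> \<open>Both sides reduce to \<open>\<delta> ^ q - \<delta>\<close>. Up to the factor
    \<open>\<alpha>\<close>, this is \<open>c ^ q = c\<close> with denominators cleared.\<close>
  have "(\<delta> + 1) * (\<delta> ^ q - 1) = - ((\<delta> ^ q + 1) * (\<delta> - 1))"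
    using e by (simp add: algebra_simps)
  then have "\<alpha> * (\<delta> + 1) * (\<delta> ^ q - 1) = - \<alpha> * (\<delta> ^ q + 1) * (\<delta> - 1)"
    by (simp add: mult.assoc)
  moreover have "c ^ q = - \<alpha> * (\<delta> ^ q + 1) / (\<delta> ^ q - 1)"
    by (simp add: c_def power_divide power_mult_distrib diff_power_q add_power_q \<alpha>_power_q)
  ultimately have "c ^ q = c"
    unfolding c_def using \<delta>1 e1 by (metis frac_eq_eq)
  then have cK: "c \<in> K"
    by (simp add: mem_K_iff)
  have "c + \<alpha> = 2 * \<alpha> * \<delta> / (\<delta> - 1)" "c - \<alpha> = 2 * \<alpha> / (\<delta> - 1)"
    using \<delta>1 by (simp_all add: c_def field_simps)
  then have "(c + \<alpha>) / (c - \<alpha>) = \<delta>"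
    using \<delta>1 two_nonzero \<alpha>_nonzero by simp
  then have "c \<in> meeting_points K m \<alpha>"
    using cK assms(1) by (simp add: meeting_points_eq unit_power_diff_\<alpha>_iff)
  moreover have "psi \<alpha> d (\<alpha> * \<delta>) = c"
  proof -
    have "\<alpha> * (\<alpha> * \<delta>) + d = \<alpha> * (\<alpha> * (\<delta> + 1))" "\<alpha> * \<delta> - \<alpha> = \<alpha> * (\<delta> - 1)"
      by (simp_all add: algebra_simps power2_eq_square flip: \<alpha>)
    moreover have "\<alpha> * \<delta> \<noteq> \<alpha>"
      using \<alpha>_nonzero assms(2) by simp
    ultimately show ?thesis
      using \<alpha>_nonzero by (simp add: psi_def c_def)
  qed
  ultimately show ?thesis
    by simp
qed

lemma psi_meeting_point:
  assumes "c \<in> meeting_points K m \<alpha>"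
  shows "\<exists>\<delta>. \<delta> ^ n = 1 \<and> psi \<alpha> d (\<alpha> * \<delta>) = c"
proof -
  have c: "c \<in> K" "((c + \<alpha>) / (c - \<alpha>)) ^ n = 1"
    using assms by (auto simp: meeting_points_eq unit_power_diff_\<alpha>_iff)
  then have "psi \<alpha> d c = \<alpha> * ((c + \<alpha>) / (c - \<alpha>))"
    using \<alpha>_notin_K by (auto simp: psi_def algebra_simps power2_eq_square simp flip: \<alpha>)
  then show ?thesis
    using c(2) psi_involution[of c] by auto
qed

text \<open>The root \<open>\<delta> = 1\<close> yields the fixed point \<open>\<alpha>\<close>; the
  other roots yield the meeting points.\<close>

lemma psi_image: "psi \<alpha> d ` {\<alpha> * \<delta> | \<delta>. \<delta> ^ n = 1} = insert \<alpha> (meeting_points K m \<alpha>)"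
proof (intro set_eqI iffI)
  fix x
  assume "x \<in> psi \<alpha> d ` {\<alpha> * \<delta> | \<delta>. \<delta> ^ n = 1}"
  then obtain \<delta> where "\<delta> ^ n = 1" "x = psi \<alpha> d (\<alpha> * \<delta>)"
    by auto
  then show "x \<in> insert \<alpha> (meeting_points K m \<alpha>)"
    using psi_root_of_unity by (cases "\<delta> = 1") (auto simp: psi_def)
next
  fix x
  assume "x \<in> insert \<alpha> (meeting_points K m \<alpha>)"
  then have "\<exists>\<delta>. \<delta> ^ n = 1 \<and> psi \<alpha> d (\<alpha> * \<delta>) = x"
  proof
    assume "x = \<alpha>"
    then show ?thesis
      by (intro exI[of _ 1]) (simp add: psi_def)
  qed (rule psi_meeting_point)
  then show "x \<in> psi \<alpha> d ` {\<alpha> * \<delta> | \<delta>. \<delta> ^ n = 1}"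
    by blast
qed

lemma psi_0: "psi \<alpha> d 0 = - \<alpha>"
  using \<alpha>_nonzero by (simp add: psi_def power2_eq_square flip: \<alpha>)

text \<open>The injective map \<open>psi\<close> transfers the count from the \<open>n\<close> roots
  of unity.\<close>

lemma card_insert_meeting_points: "card (insert \<alpha> (meeting_points K m \<alpha>)) = n"
proof -
  have "card (insert \<alpha> (meeting_points K m \<alpha>)) = card {\<alpha> * \<delta> | \<delta>. \<delta> ^ n = 1}"
    unfolding psi_image[symmetric] by (rule card_image[OF inj_psi])
  also have "{\<alpha> * \<delta> | \<delta>. \<delta> ^ n = 1} = (\<lambda>\<delta>. \<alpha> * \<delta>) ` {\<delta>. \<delta> ^ n = 1}"
    by auto
  also have "card \<dots> = card {\<delta> :: 'a. \<delta> ^ n = 1}"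
    using \<alpha>_nonzero by (intro card_image) (auto simp: inj_on_def)
  also have "\<dots> = n"
    using units_factor factor_pos
    by (intro roots_of_unity_eq_powers(2)[OF \<beta>, of "m * (q - 1)"]) (auto simp: mult_ac)
  finally show ?thesis .
qed

lemma meeting_points_subset: "meeting_points K m \<alpha> \<subseteq> K"
  by (auto simp: meeting_points_eq)

lemma card_meeting_points: "card (meeting_points K m \<alpha>) = n - 1"
  using card_insert_meeting_points meeting_points_subset \<alpha>_notin_K by (auto simp: card_insert_if)

lemma card_insert_minus_\<alpha>: "card (insert (- \<alpha>) (insert \<alpha> (meeting_points K m \<alpha>))) = n + 1"
proof -
  have "- \<alpha> \<noteq> \<alpha>"
    using \<alpha>_nonzero two_nonzero by (simp add: eq_commute[of _ \<alpha>] eq_neg_iff_add_eq_0 flip: mult_2)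
  then have "- \<alpha> \<notin> insert \<alpha> (meeting_points K m \<alpha>)"
    using meeting_points_subset minus_\<alpha>_notin_K by auto
  then show ?thesis
    by (simp add: card_insert_meeting_points)
qed

section \<open>Cliques in the generalised Paley graph\<close>

lemma unit_power_uminus: "unit_power m x \<Longrightarrow> unit_power m (- x)" for x :: 'a
  using unit_power_mult[of "- 1" x] unit_power_K[of "- 1"] K_closed by simp

lemma GP_edge_iff: "{x, y} \<in> GP_edges m \<longleftrightarrow> x \<noteq> y \<and> unit_power m (x - y)" for x y :: 'a
proof
  assume "{x, y} \<in> GP_edges m"
  then obtain a b where "{x, y} = {a, b}" "a \<noteq> b" "unit_power m (a - b)"
    by (auto simp: GP_edges_def)
  then show "x \<noteq> y \<and> unit_power m (x - y)"
    using unit_power_uminus[of "a - b"] by (auto simp: doubleton_eq_iff)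
qed (auto simp: GP_edges_def)

text \<open>Used twice, to adjoin first \<open>\<alpha>\<close> and then \<open>- \<alpha>\<close>
  to a clique contained in \<open>K\<close>.\<close>

lemma clique_insert:
  fixes v :: 'a
  assumes "clique A (GP_edges m)" "\<And>x. x \<in> A \<Longrightarrow> x \<noteq> v \<Longrightarrow> unit_power m (x - v)"
  shows "clique (insert v A) (GP_edges m)"
proof -
  have "{x, v} \<in> GP_edges m" "{v, x} \<in> GP_edges m" if "x \<in> A" "x \<noteq> v" for x
    using that assms(2) GP_edge_iff[of x v] by (auto simp: insert_commute)
  then show ?thesis
    using assms(1) unfolding clique_def by auto
qed

text \<open>Distinct points of \<open>K\<close> differ by a unit of \<open>K\<close>, which is an
  \<open>m\<close>-th power; the edges to \<open>\<alpha>\<close> are the defining property of the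
  meeting points.\<close>

lemma clique_meeting_points: "clique (insert \<alpha> (meeting_points K m \<alpha>)) (GP_edges m)"
proof (rule clique_insert)
  show "clique (meeting_points K m \<alpha>) (GP_edges m)"
    unfolding clique_def using meeting_points_subset
    by (auto simp: GP_edge_iff intro!: unit_power_K K_closed)
qed (auto simp: meeting_points_eq)

lemma clique_insert_minus_\<alpha>:
  assumes "even n"
  shows "clique (insert (- \<alpha>) (insert \<alpha> (meeting_points K m \<alpha>))) (GP_edges m)"
proof (rule clique_insert[OF clique_meeting_points])
  \<comment> \<open>Conjugation sends \<open>c - \<alpha>\<close> to \<open>c + \<alpha>\<close>, so
    the edges from \<open>\<alpha>\<close> to the meeting points carry over to
    \<open>- \<alpha>\<close>.\<close>
  have conj: "unit_power m (x ^ q)" if "unit_power m x" for x :: 'a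
  proof -
    have "(x ^ q) ^ ((q - 1) * n) = (x ^ ((q - 1) * n)) ^ q"
      by (simp add: mult.commute flip: power_mult)
    then show ?thesis
      using that by (simp add: unit_power_iff)
  qed
  have "\<alpha> * \<alpha> ^ (q - 1) = \<alpha> * (- 1)"
    using \<alpha>_power_q power_q[of \<alpha>] by simp
  then have "\<alpha> ^ (q - 1) = - 1"
    using \<alpha>_nonzero mult_left_cancel by blast
  \<comment> \<open>Evenness of \<open>n\<close> makes \<open>(-1) ^ n\<close> equal to 1. The
    difference between \<open>\<alpha>\<close> and \<open>- \<alpha>\<close> is then an
    \<open>m\<close>-th power too, as 2 is a unit of \<open>K\<close>.\<close>
  then have "unit_power m \<alpha>"
    using assms by (simp add: unit_power_iff power_mult)
  moreover have "2 \<in> K"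
    using K_closed(3)[OF K_closed(2,2)] by simp
  ultimately have "unit_power m (2 * \<alpha>)"
    using two_nonzero by (intro unit_power_mult[OF unit_power_K]) auto
  moreover have "unit_power m (c + \<alpha>)" if "c \<in> meeting_points K m \<alpha>" for c
    using that conj[of "c - \<alpha>"] by (auto simp: meeting_points_eq diff_power_q \<alpha>_power_q mem_K_iff)
  ultimately show "unit_power m (x - - \<alpha>)" if "x \<in> insert \<alpha> (meeting_points K m \<alpha>)" for x
    using that by auto
qed

text \<open>The generator is \<open>\<beta>\<close> to the power \<open>(q - 1) * m\<close>, and
  \<open>(q - 1) * m * n\<close> is the order of \<open>\<beta>\<close>.\<close>

lemma Q0_eq: "cyclic_subgroup ((\<beta> ^ (q - 1)) ^ m) = {x. x ^ n = 1}"
  unfolding power_mult[symmetric] using units_factor factor_pos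
  by (intro cyclic_subgroup_eq_roots_of_unity[OF \<beta>]) (auto simp: mult_ac)

end

theorem theorem4p18:
  fixes q m :: nat
    and K :: "'a::{field, finite} set"
    and d \<alpha> \<beta> \<omega> :: 'a
    and Q0 \<alpha>Q0 C :: "'a set"
    and \<psi> :: "'a \<Rightarrow> 'a"
  assumes q: "primepow q" "odd q"
    and m: "m > 1" "m dvd q + 1"
    and field_card: "card (UNIV :: 'a set) = q\<^sup>2"
    and K: "is_subfield K" "card K = q"
    and d: "d \<in> K" "d \<noteq> 0" "\<not> (\<exists>x\<in>K. x\<^sup>2 = d)"
    and \<alpha>: "\<alpha>\<^sup>2 = d"
    and \<beta>: "primitive_element \<beta>"
  defines "\<omega> \<equiv> \<beta> ^ (q - 1)"
    and "Q0 \<equiv> cyclic_subgroup (\<omega> ^ m)"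
    and "\<alpha>Q0 \<equiv> {\<alpha> * \<gamma> | \<gamma>. \<gamma> \<in> Q0}"
    and "C \<equiv> meeting_points K m \<alpha>"
    and "\<psi> \<equiv> psi \<alpha> d"
  shows "card C = (q + 1 - m) div m \<and>
    (\<not> m dvd (q + 1) div 2 \<longrightarrow>
       \<psi> ` \<alpha>Q0 = {\<alpha>} \<union> C \<and>
       clique (\<psi> ` \<alpha>Q0) (GP_edges m) \<and>
       card (\<psi> ` \<alpha>Q0) = (q + 1) div m) \<and>
    (m dvd (q + 1) div 2 \<longrightarrow>
       \<psi> ` ({0} \<union> \<alpha>Q0) = {\<alpha>, - \<alpha>} \<union> C \<and>
       clique (\<psi> ` ({0} \<union> \<alpha>Q0)) (GP_edges m) \<and>
       card (\<psi> ` ({0} \<union> \<alpha>Q0)) = (q + 1 + m) div m)"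
proof -
  obtain n where mn: "q + 1 = m * n"
    using m(2) by (elim dvdE)
  interpret affine_plane q m n K d \<alpha> \<beta>
    using assms mn by unfold_locales auto
  have n: "(q + 1) div m = n" "(q + 1 - m) div m = n - 1" "(q + 1 + m) div m = n + 1"
  proof -
    have "q + 1 - m = m * (n - 1)" "q + 1 + m = m * (n + 1)"
      using mn by (simp_all add: diff_mult_distrib2)
    then show "(q + 1) div m = n" "(q + 1 - m) div m = n - 1" "(q + 1 + m) div m = n + 1"
      using m(1) mn by simp_all
  qed
  \<comment> \<open>The divisibility enters through the parity of \<open>n\<close>, which makes
    \<open>\<alpha>\<close> and \<open>- \<alpha>\<close> adjacent.\<close>
  have even: "even n" if half: "m dvd (q + 1) div 2"
  proof -
    obtain k where "(q + 1) div 2 = m * k"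
      using half ..
    moreover have "q + 1 = 2 * ((q + 1) div 2)"
      using q(2) by simp
    ultimately have "m * n = m * (2 * k)"
      using mn by linarith
    then show ?thesis
      using m(1) by simp
  qed
  have image: "\<psi> ` \<alpha>Q0 = insert \<alpha> C"
    unfolding \<psi>_def \<alpha>Q0_def Q0_def \<omega>_def C_def Q0_eq using psi_image by simp
  then have image0: "\<psi> ` ({0} \<union> \<alpha>Q0) = insert (- \<alpha>) (insert \<alpha> C)"
    using psi_0 by (simp add: \<psi>_def)
  show ?thesis
    unfolding image image0 n
    using card_meeting_points card_insert_meeting_points card_insert_minus_\<alpha>
      clique_meeting_points clique_insert_minus_\<alpha> even
    by (auto simp: C_def)
qed

end
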